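(* Let $n \ge 1$, let $c \in \mathbb{R}^n$ be nonzero and let $\widehat{A} \in \mathbb{R}^{n\times n}$ be arbitrary. Define $$A^\star := \widehat{A} - \frac{c\,c^\top \widehat{A}}{\|c\|_2^2}.$$ Then $A^\star$ is the unique minimiser of the problem $$\min_{M \in \mathbb{R}^{n\times n}} \; \|M - \widehat{A}\|_F \quad \text{subject to} \quad c^\top M = 0^\top.$$ Moreover: (a) $c^\top A^\star = 0^\top$; (b) $A^\star - \widehat{A}$ has rank at most one, with $$A^\star - \widehat{A} = -\,\frac{c\,c^\top \widehat{A}}{\|c\|_2^2},$$ and $\operatorname{rank}(A^\star - \widehat{A}) = 1$ if and only if $c^\top \widehat{A} \neq 0^\top$.
   Context: $\|\cdot\|_2$ denotes the Euclidean norm on $\mathbb{R}^n$. The Frobenius inner product on $\mathbb{R}^{n\times n}$ is $\langle X,Y\rangle_F := \mathrm{trace}(Y^\top X)$, with associated norm $\|X\|_F := \sqrt{\langle X,X\rangle_F}$. Vectors in $\mathbb{R}^n$ are column vectors, and $0^\top$ denotes the zero row vector of length $n$. *)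

theory Defs
  imports "HOL-Analysis.Analysis"
begin

definition frobenius_inner :: "real^'n^'n \<Rightarrow> real^'n^'n \<Rightarrow> real" where
  "frobenius_inner X Y = trace (transpose Y ** X)"

definition frobenius_norm :: "real^'n^'n \<Rightarrow> real" where
  "frobenius_norm X = sqrt (frobenius_inner X X)"

(* The library's rowvector and columnvector are polymorphic in the trivial dimension, and
   with k identical columns and rows the product columnvector v ** rowvector v would be
   k times the dyad of v.  The type 1 is therefore fixed here. *)

abbreviation col_vec :: "real^'n \<Rightarrow> real^1^'n" where
  "col_vec v \<equiv> columnvector v"

abbreviation row_vec :: "real^'n \<Rightarrow> real^'n^1" where
  "row_vec v \<equiv> rowvector v"

definition A_star :: "real^'n \<Rightarrow> real^'n^'n \<Rightarrow> real^'n^'n" where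
  "A_star c A = A - (col_vec c ** row_vec c ** A) /\<^sub>R (norm c)\<^sup>2"

end

theory Submission
  imports Defs
begin

text \<open>
  The correction \<open>A\<^sup>\<star> - A\<close> is a dyad \<open>c w\<^sup>T\<close>, and \<open>\<langle>N, c w\<^sup>T\<rangle> = (c\<^sup>T N) w\<close> vanishes
  whenever \<open>c\<^sup>T N = 0\<close>. So the correction is orthogonal to every feasible direction, and
  minimality and uniqueness follow from the Pythagorean theorem.
\<close>

text \<open>The trace adds the entrywise products column by column, the inner product of
  \<open>real^'n^'n\<close> row by row. This opens the way to arguments in an arbitrary real inner
  product space.\<close>

lemma frobenius_inner_eq_inner: "frobenius_inner X Y = X \<bullet> Y"
  unfolding frobenius_inner_def inner_vec_def trace_def matrix_matrix_mult_def transpose_def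
  by (simp add: mult.commute, rule sum.swap)

lemma frobenius_norm_eq_norm: "frobenius_norm X = norm X"
  by (simp add: frobenius_norm_def frobenius_inner_eq_inner norm_eq_sqrt_inner)

lemma row_vec_mult: "row_vec c ** M = row_vec (c v* M)"
  by (simp add: vec_eq_iff matrix_matrix_mult_def rowvector_def vector_matrix_mult_def mult.commute)

lemma row_vec_eq_iff: "row_vec v = row_vec w \<longleftrightarrow> v = w"
  by (simp add: vec_eq_iff rowvector_def)

lemma dyad_nth: "(col_vec v ** row_vec w) $ i $ j = v $ i * w $ j"
  by (simp add: matrix_matrix_mult_def rowvector_def columnvector_def)

lemma inner_dyad: "X \<bullet> (col_vec v ** row_vec w) = (v v* X) \<bullet> w"
proof -
  have "X \<bullet> (col_vec v ** row_vec w) = (\<Sum>i\<in>UNIV. \<Sum>j\<in>UNIV. X $ i $ j * (v $ i * w $ j))"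
    by (simp add: inner_vec_def dyad_nth)
  also have "\<dots> = (\<Sum>j\<in>UNIV. \<Sum>i\<in>UNIV. X $ i $ j * (v $ i * w $ j))"
    by (rule sum.swap)
  also have "\<dots> = (v v* X) \<bullet> w"
    by (simp add: inner_vec_def vector_matrix_mult_def sum_distrib_left mult_ac)
  finally show ?thesis .
qed

lemma vector_mult_dyad: "u v* (col_vec v ** row_vec w) = (u \<bullet> v) *\<^sub>R w"
  by (simp add: vec_eq_iff vector_matrix_mult_def dyad_nth inner_vec_def sum_distrib_left mult_ac)

lemma dyad_eq_0_iff: "col_vec v ** row_vec w = 0 \<longleftrightarrow> v = 0 \<or> w = 0"
  unfolding vec_eq_iff[of "col_vec v ** row_vec w"] vec_eq_iff[of "(col_vec v ** row_vec w) $ _"] dyad_nth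
  by (auto simp: vec_eq_iff)

lemma rank_eq_1_iff:
  assumes "rank B \<le> 1"
  shows "rank B = 1 \<longleftrightarrow> (B :: real^'n^'m) \<noteq> 0"
  using assms rank_eq_0[of B] by linarith

text \<open>The product factors through \<open>real^1\<close>, and its left factor has a single
  column.\<close>

lemma rank_dyad_le_1: "rank (col_vec v ** row_vec w) \<le> 1"
  using rank_mul_le_left[of "col_vec v" "row_vec w"] rank_bound[of "col_vec v"] by simp

text \<open>Neither linearity nor convexity of \<open>P\<close> is assumed: orthogonality at each
  feasible point already gives Pythagoras, whose extra term \<open>(norm (y - p))\<^sup>2\<close> is
  nonnegative (minimality) and zero only at \<open>p\<close> (uniqueness).\<close>

lemma is_arg_min_norm_orthogonal:
  fixes p a :: "'a::real_inner"
  assumes "P p" and orth: "\<And>x. P x \<Longrightarrow> (x - p) \<bullet> (p - a) = 0"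
  shows "is_arg_min (\<lambda>x. norm (x - a)) P x \<longleftrightarrow> x = p"
proof -
  have pyth: "(norm (y - a))\<^sup>2 = (norm (y - p))\<^sup>2 + (norm (p - a))\<^sup>2" if "P y" for y
    using norm_add_Pythagorean[of "y - p" "p - a"] orth[OF that] by (simp add: orthogonal_def)
  have le: "norm (p - a) \<le> norm (y - a)" if "P y" for y
    by (rule power2_le_imp_le) (simp_all add: pyth[OF that])
  have "y = p" if "P y" "norm (y - a) \<le> norm (p - a)" for y
  proof -
    have "norm (y - a) = norm (p - a)" using le that by fastforce
    then show ?thesis using pyth[OF that(1)] by simp
  qed
  then show ?thesis
    using \<open>P p\<close> le by (auto simp: is_arg_min_def not_less[symmetric] intro: leI)
qed

theorem theorem1:
  fixes c :: "real^'n" and A :: "real^'n^'n"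
  assumes "c \<noteq> 0"
  shows "(\<forall>M :: real^'n^'n.
            is_arg_min (\<lambda>M. frobenius_norm (M - A)) (\<lambda>M. row_vec c ** M = row_vec 0) M
              \<longleftrightarrow> M = A_star c A) \<and>
         row_vec c ** A_star c A = row_vec 0 \<and>
         rank (A_star c A - A) \<le> 1 \<and>
         A_star c A - A = - ((col_vec c ** row_vec c ** A) /\<^sub>R (norm c)\<^sup>2) \<and>
         (rank (A_star c A - A) = 1 \<longleftrightarrow> row_vec c ** A \<noteq> row_vec 0)"
proof -
  \<comment> \<open>The sign and the scaling go into the row factor, so that the correction is
    exactly the dyad of \<open>c\<close> and \<open>w\<close>.\<close>
  define w where "w = (- inverse ((norm c)\<^sup>2)) *\<^sub>R (c v* A)"
  have diff: "A_star c A - A = - ((col_vec c ** row_vec c ** A) /\<^sub>R (norm c)\<^sup>2)"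
    by (simp add: A_star_def)
  have dyad: "A_star c A - A = col_vec c ** row_vec w"
    \<comment> \<open>Bracketing as c (c^T A) exposes the row factor c^T A.\<close>
    unfolding diff matrix_mul_assoc[symmetric] row_vec_mult
    by (simp add: vec_eq_iff dyad_nth w_def)
  \<comment> \<open>The factor \<open>c \<bullet> c\<close> from \<open>vector_mult_dyad\<close>
    cancels the inverse in \<open>w\<close>, since \<open>c\<close> is nonzero.\<close>
  have "c v* (A_star c A - A) = - (c v* A)"
    using assms by (simp add: dyad vector_mult_dyad w_def power2_norm_eq_inner)
  then have feasible: "c v* A_star c A = 0"
    by (simp add: vector_matrix_mult_diff_rdistrib)
  have "is_arg_min (\<lambda>M. frobenius_norm (M - A)) (\<lambda>M. row_vec c ** M = row_vec 0) M
      \<longleftrightarrow> M = A_star c A" for M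
    unfolding frobenius_norm_eq_norm row_vec_mult row_vec_eq_iff
    \<comment> \<open>By \<open>inner_dyad\<close>, orthogonality becomes
      \<open>(c v* (M - A_star c A)) \<bullet> w = 0\<close>, where both \<open>M\<close> and
      \<open>A_star c A\<close> are feasible.\<close>
    by (rule is_arg_min_norm_orthogonal)
      (simp_all add: feasible dyad inner_dyad vector_matrix_mult_diff_rdistrib)
  moreover have rank: "rank (A_star c A - A) \<le> 1"
    unfolding dyad by (rule rank_dyad_le_1)
  moreover have "rank (A_star c A - A) = 1 \<longleftrightarrow> row_vec c ** A \<noteq> row_vec 0"
    \<comment> \<open>Rank one now means that the dyad is nonzero; as \<open>c\<close> is nonzero,
      this depends on \<open>w\<close> alone, a nonzero multiple of \<open>c v* A\<close>.\<close>
    unfolding rank_eq_1_iff[OF rank] unfolding dyad dyad_eq_0_iff row_vec_mult row_vec_eq_iff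
    using assms by (simp add: w_def)
  ultimately show ?thesis
    using feasible diff by (simp add: row_vec_mult)
qed

end
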